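(* Let $\mathcal I$ be an ideal on $\mathbb N$. If $\mathcal I$ is meager, then $c_{0,\mathsf{Fin}\times\mathcal I}$ is not a Grothendieck space.
   Context: An ideal on a countable set $S$ is a collection of subsets of $S$ containing $\emptyset$ and all finite subsets of $S$, closed under taking subsets and finite unions (it need not be proper). An ideal on $\mathbb N$ is meager if, identified via characteristic functions with a subset of the Cantor space $\{0,1\}^{\mathbb N}$, it is a meager set. $\mathsf{Fin}$ is the ideal of finite subsets of $\mathbb N$. The Fubini product $\mathcal I_1\times\mathcal I_2$ of ideals on $\mathbb N$ is the ideal on $\mathbb N\times\mathbb N$ with $A\in\mathcal I_1\times\mathcal I_2$ iff $\{n\in\mathbb N:\{m\in\mathbb N:(n,m)\in A\}\notin\mathcal I_2\}\in\mathcal I_1$. For an ideal $\mathcal K$ on a countable set $S$, $c_{0,\mathcal K}$ is the space of bounded real families $(x_s)_{s\in S}$ such that $\{s\in S:|x_s|\ge\varepsilon\}\in\mathcal K$ for every $\varepsilon>0$, with the sup norm. A Banach space $X$ is Grothendieck if every bounded linear operator from $X$ to $c_0$ is weakly compact. *)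

theory Defs
  imports "HOL-Analysis.Analysis"
begin

definition is_ideal :: "'s::countable set set \<Rightarrow> bool" where
  "is_ideal I \<longleftrightarrow>
     {} \<in> I \<and> (\<forall>A. finite A \<longrightarrow> A \<in> I) \<and>
     (\<forall>A\<in>I. \<forall>B. B \<subseteq> A \<longrightarrow> B \<in> I) \<and>
     (\<forall>A\<in>I. \<forall>B\<in>I. A \<union> B \<in> I)"

definition Fin :: "nat set set" where
  "Fin = {A. finite A}"

definition fubini_product :: "nat set set \<Rightarrow> nat set set \<Rightarrow> (nat \<times> nat) set set"  (infixr \<open>\<times>\<^sub>F\<close> 80) where
  "I \<times>\<^sub>F J = {A. {n. {m. (n, m) \<in> A} \<notin> J} \<in> I}"

definition meager :: "'a::topological_space set \<Rightarrow> bool" where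
  "meager A \<longleftrightarrow>
     (\<exists>N :: nat \<Rightarrow> 'a set. (\<forall>k. interior (closure (N k)) = {}) \<and> A \<subseteq> (\<Union>k. N k))"

text \<open>The Cantor space is the type \<^typ>\<open>nat \<Rightarrow> bool\<close>, which carries the product topology of the
  discrete two-point space; the predicate \<^term>\<open>\<lambda>n. n \<in> A\<close> is the characteristic function of \<^term>\<open>A\<close>.\<close>

definition meager_ideal :: "nat set set \<Rightarrow> bool" where
  "meager_ideal I \<longleftrightarrow> meager ((\<lambda>A n. n \<in> A) ` I)"

text \<open>On a discrete index type every function is continuous, so \<^typ>\<open>'s \<Rightarrow>\<^sub>C real\<close> is the Banach space
  of all bounded real families, with the sup norm. Its closed subspaces are represented as sets, with the
  inherited norm.\<close>

instance prod :: (discrete_topology, discrete_topology) discrete_topology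
proof
  fix A :: "('a \<times> 'b) set"
  have "open (\<Union>x\<in>A. {fst x} \<times> {snd x})"
    by (intro open_UN ballI) (rule open_Times; rule open_discrete)
  moreover have "(\<Union>x\<in>A. {fst x} \<times> {snd x}) = A" by auto
  ultimately show "open A" by metis
qed

definition c0_ideal :: "'s::{countable,discrete_topology} set set \<Rightarrow> ('s \<Rightarrow>\<^sub>C real) set" where
  "c0_ideal K = {x. \<forall>\<epsilon>>0. {s. \<bar>apply_bcontfun x s\<bar> \<ge> \<epsilon>} \<in> K}"

definition c0 :: "(nat \<Rightarrow>\<^sub>C real) set" where
  "c0 = {x. apply_bcontfun x \<longlonglongrightarrow> 0}"

text \<open>In the following definitions \<^term>\<open>X\<close> and \<^term>\<open>Y\<close> stand for linear subspaces. Maps between them are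
  represented by functions on the ambient types, whose values outside \<^term>\<open>X\<close> are irrelevant.\<close>

definition bounded_linear_on ::
    "'a::real_normed_vector set \<Rightarrow> ('a \<Rightarrow> 'b::real_normed_vector) \<Rightarrow> bool" where
  "bounded_linear_on X T \<longleftrightarrow>
     (\<forall>x\<in>X. \<forall>y\<in>X. T (x + y) = T x + T y) \<and>
     (\<forall>c. \<forall>x\<in>X. T (c *\<^sub>R x) = c *\<^sub>R T x) \<and>
     (\<exists>C. \<forall>x\<in>X. norm (T x) \<le> C * norm x)"

definition weak_topology :: "'a::real_normed_vector set \<Rightarrow> 'a topology" where
  "weak_topology Y =
     topology_generated_by
       {{y \<in> Y. f y \<in> U} | (f :: 'a \<Rightarrow> real) U. bounded_linear_on Y f \<and> open U}"

definition weakly_compact_operator ::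
    "'a::real_normed_vector set \<Rightarrow> 'b::real_normed_vector set \<Rightarrow> ('a \<Rightarrow> 'b) \<Rightarrow> bool" where
  "weakly_compact_operator X Y T \<longleftrightarrow>
     compactin (weak_topology Y) (weak_topology Y closure_of (T ` (X \<inter> cball 0 1)))"

definition grothendieck_space :: "'a::real_normed_vector set \<Rightarrow> bool" where
  "grothendieck_space X \<longleftrightarrow>
     (\<forall>T :: 'a \<Rightarrow> (nat \<Rightarrow>\<^sub>C real).
        bounded_linear_on X T \<and> T ` X \<subseteq> c0 \<longrightarrow> weakly_compact_operator X c0 T)"

lemma is_ideal_Fin: "is_ideal Fin"
  by (auto simp: is_ideal_def Fin_def intro: finite_subset)

lemma is_ideal_fubini_product:
  assumes I: "is_ideal I" and J: "is_ideal J"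
  shows "is_ideal (I \<times>\<^sub>F J)"
proof -
  have sub: "\<And>A B. A \<in> I \<Longrightarrow> B \<subseteq> A \<Longrightarrow> B \<in> I" and subJ: "\<And>A B. A \<in> J \<Longrightarrow> B \<subseteq> A \<Longrightarrow> B \<in> J"
    and un: "\<And>A B. A \<in> I \<Longrightarrow> B \<in> I \<Longrightarrow> A \<union> B \<in> I" and unJ: "\<And>A B. A \<in> J \<Longrightarrow> B \<in> J \<Longrightarrow> A \<union> B \<in> J"
    and fin: "\<And>A. finite A \<Longrightarrow> A \<in> I" and finJ: "\<And>A. finite A \<Longrightarrow> A \<in> J"
    using I J by (auto simp: is_ideal_def)
  have 1: "A \<in> I \<times>\<^sub>F J" if "finite A" for A
  proof -
    have "{m. (n, m) \<in> A} \<in> J" for n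
      by (intro finJ finite_subset[OF _ finite_imageI[OF that, of snd]]) force
    then show ?thesis by (simp add: fubini_product_def fin)
  qed
  have 2: "B \<in> I \<times>\<^sub>F J" if "A \<in> I \<times>\<^sub>F J" "B \<subseteq> A" for A B
  proof -
    have "{n. {m. (n, m) \<in> B} \<notin> J} \<subseteq> {n. {m. (n, m) \<in> A} \<notin> J}"
    proof safe
      fix n assume "{m. (n, m) \<in> B} \<notin> J" "{m. (n, m) \<in> A} \<in> J"
      then show False using subJ[of "{m. (n, m) \<in> A}" "{m. (n, m) \<in> B}"] that(2) by blast
    qed
    then show ?thesis using that(1) sub by (auto simp: fubini_product_def)
  qed
  have 3: "A \<union> B \<in> I \<times>\<^sub>F J" if "A \<in> I \<times>\<^sub>F J" "B \<in> I \<times>\<^sub>F J" for A B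
  proof -
    have "{n. {m. (n, m) \<in> A \<union> B} \<notin> J} \<subseteq> {n. {m. (n, m) \<in> A} \<notin> J} \<union> {n. {m. (n, m) \<in> B} \<notin> J}"
    proof safe
      fix n assume *: "{m. (n, m) \<in> A \<union> B} \<notin> J" "{m. (n, m) \<in> A} \<in> J" "{m. (n, m) \<in> B} \<in> J"
      have "{m. (n, m) \<in> A \<union> B} = {m. (n, m) \<in> A} \<union> {m. (n, m) \<in> B}" by auto
      then show False using * unJ by metis
    qed
    moreover have "{n. {m. (n, m) \<in> A} \<notin> J} \<union> {n. {m. (n, m) \<in> B} \<notin> J} \<in> I"
      using that un by (auto simp: fubini_product_def)
    ultimately show ?thesis using sub by (auto simp: fubini_product_def)
  qed
  show ?thesis unfolding is_ideal_def using 1 2 3 by auto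
qed

lemma subspace_c0_ideal:
  assumes "is_ideal K"
  shows "subspace (c0_ideal K)"
proof -
  have sub: "\<And>A B. A \<in> K \<Longrightarrow> B \<subseteq> A \<Longrightarrow> B \<in> K" and un: "\<And>A B. A \<in> K \<Longrightarrow> B \<in> K \<Longrightarrow> A \<union> B \<in> K"
    and emp: "{} \<in> K"
    using assms by (auto simp: is_ideal_def)
  show ?thesis
  proof (rule subspaceI)
    show "0 \<in> c0_ideal K" using emp by (auto simp: c0_ideal_def)
  next
    fix x y assume x: "x \<in> c0_ideal K" and y: "y \<in> c0_ideal K"
    have "{s. \<epsilon> \<le> \<bar>apply_bcontfun (x + y) s\<bar>} \<in> K" if "\<epsilon> > 0" for \<epsilon>
    proof (rule sub)
      show "{s. \<epsilon>/2 \<le> \<bar>apply_bcontfun x s\<bar>} \<union> {s. \<epsilon>/2 \<le> \<bar>apply_bcontfun y s\<bar>} \<in> K"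
        using x y half_gt_zero[OF that] unfolding c0_ideal_def by (intro un) blast+
    qed auto
    then show "x + y \<in> c0_ideal K" by (auto simp: c0_ideal_def)
  next
    fix c :: real and x assume x: "x \<in> c0_ideal K"
    have "{s. \<epsilon> \<le> \<bar>apply_bcontfun (c *\<^sub>R x) s\<bar>} \<in> K" if "\<epsilon> > 0" for \<epsilon>
    proof (cases "c = 0")
      case True
      then show ?thesis using emp that by auto
    next
      case False
      have "{s. \<epsilon> \<le> \<bar>apply_bcontfun (c *\<^sub>R x) s\<bar>} = {s. \<epsilon> / \<bar>c\<bar> \<le> \<bar>apply_bcontfun x s\<bar>}"
        using False by (auto simp: abs_mult field_simps)
      then show ?thesis using x False that by (auto simp: c0_ideal_def)
    qed
    then show "c *\<^sub>R x \<in> c0_ideal K" by (auto simp: c0_ideal_def)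
  qed
qed

lemma closed_c0_ideal:
  assumes "is_ideal K"
  shows "closed (c0_ideal K)"
  unfolding closed_sequential_limits
proof safe
  fix f l assume f: "\<forall>n. f n \<in> c0_ideal K" and l: "f \<longlonglongrightarrow> l"
  have "{s. \<epsilon> \<le> \<bar>apply_bcontfun l s\<bar>} \<in> K" if pos: "\<epsilon> > 0" for \<epsilon>
  proof -
    obtain n where n: "dist (f n) l < \<epsilon>/2"
      using metric_LIMSEQ_D[OF l half_gt_zero[OF pos]] by blast
    have "{s. \<epsilon> \<le> \<bar>apply_bcontfun l s\<bar>} \<subseteq> {s. \<epsilon>/2 \<le> \<bar>apply_bcontfun (f n) s\<bar>}"
    proof safe
      fix s assume "\<epsilon> \<le> \<bar>apply_bcontfun l s\<bar>"
      then show "\<epsilon>/2 \<le> \<bar>apply_bcontfun (f n) s\<bar>"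
        using dist_bounded[of "f n" s l] n by (auto simp: dist_real_def)
    qed
    moreover have "{s. \<epsilon>/2 \<le> \<bar>apply_bcontfun (f n) s\<bar>} \<in> K"
      using f half_gt_zero[OF pos] unfolding c0_ideal_def by blast
    ultimately show ?thesis using assms unfolding is_ideal_def by blast
  qed
  then show "l \<in> c0_ideal K" by (auto simp: c0_ideal_def)
qed

lemma c0_eq_c0_ideal_Fin: "c0 = c0_ideal Fin"
proof -
  have "(apply_bcontfun x \<longlonglongrightarrow> 0) \<longleftrightarrow> (\<forall>\<epsilon>>0. finite {s. \<epsilon> \<le> \<bar>apply_bcontfun x s\<bar>})" for x :: "nat \<Rightarrow>\<^sub>C real"
    by (simp add: tendsto_iff eventually_cofinite cofinite_eq_sequentially[symmetric] not_less)
  then show ?thesis by (auto simp: c0_def c0_ideal_def Fin_def)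
qed

lemma topspace_weak_topology: "topspace (weak_topology Y) = Y"
proof -
  have "bounded_linear_on Y (\<lambda>_::'a. 0::real)"
    by (auto simp: bounded_linear_on_def intro!: exI[of _ 0])
  then have "Y \<in> {{y \<in> Y. f y \<in> U} | (f :: 'a \<Rightarrow> real) U. bounded_linear_on Y f \<and> open U}"
    by (intro CollectI exI[of _ "\<lambda>_. 0"] exI[of _ UNIV]) auto
  then show ?thesis
    unfolding weak_topology_def topology_generated_by_topspace by blast
qed

end

theory Submission
  imports Defs
begin

text \<open>A meager ideal \<open>I\<close> does not contain \<open>\<nat>\<close>, by the Baire category theorem, so some ultrafilter
  \<open>U\<close> refines its dual filter. For \<open>x\<close> in \<open>c\<^sub>0\<close> over \<open>Fin \<times> I\<close> the limits along \<open>U\<close> of the columns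
  \<open>x (n, \<cdot>)\<close> tend to \<open>0\<close> as \<open>n \<rightarrow> \<infinity>\<close>, and this gives an operator onto \<open>c\<^sub>0\<close>. It is not weakly
  compact: the image of the unit ball contains the indicator functions of all initial segments of
  \<open>\<nat>\<close>, so finitely many of the weakly open sets \<open>{y. y n < 1}\<close>, which cover \<open>c\<^sub>0\<close>, never suffice.\<close>

section \<open>Baire category and properness of meager ideals\<close>

lemma not_meager_UNIV_fun:
  "\<not> meager (UNIV :: ('i::countable \<Rightarrow> 'a::discrete_topology) set)"
proof
  assume "meager (UNIV :: ('i \<Rightarrow> 'a) set)"
  then obtain N :: "nat \<Rightarrow> ('i \<Rightarrow> 'a) set"
    where N: "\<And>k. interior (closure (N k)) = {}" and un: "(\<Union>k. N k) = UNIV"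
    unfolding meager_def by blast
  \<comment> \<open>Discrete spaces are completely metrizable, and countable products preserve this;
    hence the index type is countable.\<close>
  have "(euclidean :: 'a topology) = discrete_topology UNIV"
    by (simp add: topology_eq open_discrete)
  then have "completely_metrizable_space (product_topology (\<lambda>_. euclidean :: 'a topology) (UNIV :: 'i set))"
    by (simp add: completely_metrizable_space_product_topology completely_metrizable_space_discrete_topology)
  then have "completely_metrizable_space (euclidean :: ('i \<Rightarrow> 'a) topology)"
    by (simp add: euclidean_product_topology)
  then have "euclidean interior_of \<Union>(range (\<lambda>k. closure (N k))) = {}"
    by (intro Baire_category_alt) (use N in auto)
  moreover have "(\<Union>k. closure (N k)) = UNIV"
    using un closure_subset by blast
  ultimately show False
    by simp
qed

lemma UNIV_notin_meager_ideal:
  assumes "is_ideal I" "meager_ideal I"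
  shows "UNIV \<notin> I"
proof
  assume "UNIV \<in> I"
  then have "A \<in> I" for A
    using assms(1) unfolding is_ideal_def by blast
  then have "P \<in> (\<lambda>A n. n \<in> A) ` I" for P
    by (intro image_eqI[of _ _ "{n. P n}"]) auto
  then have "(\<lambda>A n. n \<in> A) ` I = UNIV"
    by blast
  then show False
    using assms(2) not_meager_UNIV_fun by (metis meager_ideal_def)
qed

section \<open>Ultrafilters and limits along them\<close>

definition ultrafilter :: "'a filter \<Rightarrow> bool" where
  "ultrafilter U \<longleftrightarrow> U \<noteq> bot \<and> (\<forall>F\<le>U. F \<noteq> bot \<longrightarrow> F = U)"

text \<open>Zorn's lemma for the reversed order: smaller filters are finer, so an ultrafilter is a
  minimal proper filter.\<close>

lemma ultrafilter_exists:
  fixes F :: "'a filter"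
  assumes "F \<noteq> bot"
  obtains U where "ultrafilter U" "U \<le> F"
proof -
  let ?A = "{G. G \<noteq> bot \<and> G \<le> F}"
  have "\<exists>U\<in>?A. \<forall>G\<in>?A. U \<ge> G \<longrightarrow> G = U"
  proof (rule predicate_Zorn)
    show "partial_order_on ?A (relation_of (\<ge>) ?A)"
      by (rule partial_order_on_relation_ofI) auto
  next
    fix C assume C: "C \<in> Chains (relation_of (\<ge>) ?A)"
    then have sub: "C \<subseteq> ?A" and chain: "\<And>G H. G \<in> C \<Longrightarrow> H \<in> C \<Longrightarrow> G \<le> H \<or> H \<le> G"
      by (auto simp: Chains_def relation_of_def)
    show "\<exists>u\<in>?A. \<forall>G\<in>C. G \<ge> u"
    proof (cases "C = {}")
      case True
      then show ?thesis using assms by auto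
    next
      case False
      \<comment> \<open>A chain is a filter base, so a property holding eventually along the infimum
        already does so along one member. Hence \<open>Inf C\<close> is proper.\<close>
      have "eventually P (Inf C) \<longleftrightarrow> (\<exists>G\<in>C. eventually P G)" for P
        proof (rule eventually_Inf_base[OF False])
          show "\<exists>x\<in>C. x \<le> inf G H" if "G \<in> C" "H \<in> C" for G H
            using chain[OF that] that by auto
        qed
      then have "Inf C \<noteq> bot"
        using sub unfolding trivial_limit_def by blast
      moreover have "Inf C \<le> F"
        using False sub by (blast intro: Inf_lower2)
      ultimately show ?thesis
        by (auto intro: Inf_lower)
    qed
  qed
  then show thesis
    using that unfolding ultrafilter_def by (blast intro: order_trans)
qed

text \<open>Compactness provides a cluster point of the image filter, and minimality of
  \<open>U\<close> turns it into a limit.\<close>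

lemma ultrafilter_tendsto_compact:
  assumes U: "ultrafilter U" and "compact S" "\<And>x. f x \<in> S"
  obtains l where "l \<in> S" "(f \<longlongrightarrow> l) U"
proof -
  have "filtermap f U \<noteq> bot" "eventually (\<lambda>x. x \<in> S) (filtermap f U)"
    using U assms(3) by (simp_all add: ultrafilter_def filtermap_bot_iff eventually_filtermap)
  then obtain l where l: "l \<in> S" "inf (nhds l) (filtermap f U) \<noteq> bot"
    using \<open>compact S\<close> unfolding compact_filter by blast
  \<comment> \<open>The cluster property is pulled back along \<open>f\<close>. The resulting proper
    filter lies below \<open>U\<close>, hence equals it, and this is convergence to
    \<open>l\<close>.\<close>
  have "inf U (filtercomap f (nhds l)) \<noteq> bot"
  proof
    assume "inf U (filtercomap f (nhds l)) = bot"
    then obtain P Q where "eventually P U" "eventually Q (nhds l)" "\<And>x. P x \<Longrightarrow> \<not> Q (f x)"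
      unfolding trivial_limit_def eventually_inf eventually_filtercomap by blast
    then have "eventually (\<lambda>y. \<not> Q y) (filtermap f U)"
      by (auto simp: eventually_filtermap elim: eventually_mono)
    with \<open>eventually Q (nhds l)\<close> have "inf (nhds l) (filtermap f U) = bot"
      unfolding trivial_limit_def eventually_inf by blast
    with l show False by simp
  qed
  then have "inf U (filtercomap f (nhds l)) = U"
    using U unfolding ultrafilter_def by (simp add: inf_le1)
  then have "(f \<longlongrightarrow> l) U"
    by (metis filterlim_iff_le_filtercomap inf_le2)
  with l that show thesis by blast
qed

lemma ultrafilter_tendsto_Lim_bounded:
  fixes f :: "'a \<Rightarrow> real"
  assumes U: "ultrafilter U" and b: "\<And>x. \<bar>f x\<bar> \<le> b"
  shows "(f \<longlongrightarrow> Lim U f) U" "\<bar>Lim U f\<bar> \<le> b"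
proof -
  obtain l where "l \<in> cball 0 b" "(f \<longlongrightarrow> l) U"
    using ultrafilter_tendsto_compact[OF U compact_cball, of f 0 b] b by auto
  moreover from this have "Lim U f = l"
    using U by (simp add: tendsto_Lim ultrafilter_def)
  ultimately show "(f \<longlongrightarrow> Lim U f) U" "\<bar>Lim U f\<bar> \<le> b"
    by auto
qed

text \<open>Closure under unions makes the complements of members of \<open>I\<close> a filter base;
  it generates a proper filter because no complement is empty.\<close>

lemma ultrafilter_avoiding_ideal:
  assumes I: "is_ideal I" and "UNIV \<notin> I"
  obtains U where "ultrafilter U" "\<And>A. A \<in> I \<Longrightarrow> eventually (\<lambda>x. x \<notin> A) U"
proof -
  let ?F = "INF A\<in>I. principal (- A)"
  have "eventually P ?F \<longleftrightarrow> (\<exists>A\<in>I. eventually P (principal (- A)))" for P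
  proof (rule eventually_INF_base)
    show "I \<noteq> {}" using I by (auto simp: is_ideal_def)
    show "\<exists>C\<in>I. principal (- C) \<le> inf (principal (- A)) (principal (- B))" if "A \<in> I" "B \<in> I" for A B
      using I that by (intro bexI[of _ "A \<union> B"]) (auto simp: is_ideal_def)
  qed
  then have "?F \<noteq> bot"
    using \<open>UNIV \<notin> I\<close> unfolding trivial_limit_def eventually_principal
    by (metis ComplI UNIV_eq_I)
  then obtain U where U: "ultrafilter U" "U \<le> ?F"
    by (rule ultrafilter_exists)
  have "eventually (\<lambda>x. x \<notin> A) U" if "A \<in> I" for A
    by (rule filter_leD[OF order_trans[OF U(2) INF_lower[OF that]]]) (simp add: eventually_principal)
  with U(1) that show thesis by blast
qed

section \<open>The operator of column limits\<close>

definition column_limits :: "'b filter \<Rightarrow> (('a::discrete_topology \<times> 'b::discrete_topology) \<Rightarrow>\<^sub>C real) \<Rightarrow> ('a \<Rightarrow>\<^sub>C real)"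
  where "column_limits U x = Bcontfun (\<lambda>n. Lim U (\<lambda>m. apply_bcontfun x (n, m)))"

context
  fixes U :: "'b::discrete_topology filter"
  assumes U: "ultrafilter U"
begin

lemma column_limits_apply:
  "apply_bcontfun (column_limits U x) n = Lim U (\<lambda>m. apply_bcontfun x (n, m))"
proof -
  \<comment> \<open>All columns share the bound \<open>norm x\<close>, and so do their limits;
    \<open>Bcontfun\<close> is meaningful only on such bounded families.\<close>
  have "(\<lambda>n. Lim U (\<lambda>m. apply_bcontfun x (n, m))) \<in> bcontfun"
  proof (rule bcontfun_normI)
    show "norm (Lim U (\<lambda>m. apply_bcontfun x (n, m))) \<le> norm x" for n
      using ultrafilter_tendsto_Lim_bounded(2)[OF U, of "\<lambda>m. apply_bcontfun x (n, m)"] norm_bounded[of x]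
      by simp
  qed simp
  then show ?thesis
    by (simp add: column_limits_def Bcontfun_inverse)
qed

lemma tendsto_column_limits:
  "((\<lambda>m. apply_bcontfun x (n, m)) \<longlongrightarrow> apply_bcontfun (column_limits U x) n) U"
  using ultrafilter_tendsto_Lim_bounded(1)[OF U, of "\<lambda>m. apply_bcontfun x (n, m)" "norm x"] norm_bounded[of x]
  by (simp add: column_limits_apply)

text \<open>Uniqueness of limits along a proper filter. Values of the operator can thus be computed
  from convergence of each column.\<close>

lemma column_limits_eqI:
  assumes "\<And>n. ((\<lambda>m. apply_bcontfun x (n, m)) \<longlongrightarrow> apply_bcontfun y n) U"
  shows "column_limits U x = y"
  using U assms by (auto intro!: bcontfun_eqI simp: column_limits_apply tendsto_Lim ultrafilter_def)

lemma bounded_linear_on_column_limits: "bounded_linear_on X (column_limits U)"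
  unfolding bounded_linear_on_def
proof (intro conjI exI[of _ 1] ballI allI)
  fix x y :: "('a::discrete_topology \<times> 'b) \<Rightarrow>\<^sub>C real" and c :: real
  show "column_limits U (x + y) = column_limits U x + column_limits U y"
    by (rule column_limits_eqI) (auto intro!: tendsto_add tendsto_column_limits)
  show "column_limits U (c *\<^sub>R x) = c *\<^sub>R column_limits U x"
    by (rule column_limits_eqI) (auto intro!: tendsto_mult tendsto_column_limits)
  show "norm (column_limits U x) \<le> 1 * norm x"
    using ultrafilter_tendsto_Lim_bounded(2)[OF U, of "\<lambda>m. apply_bcontfun x (_, m)"] norm_bounded[of x]
    by (auto intro!: norm_bound simp: column_limits_apply)
qed

end

lemma column_limits_c0_ideal:
  assumes U: "ultrafilter U" and IU: "\<And>A. A \<in> I \<Longrightarrow> eventually (\<lambda>m. m \<notin> A) U"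
    and x: "x \<in> c0_ideal (Fin \<times>\<^sub>F I)"
  shows "column_limits U x \<in> c0"
  unfolding c0_eq_c0_ideal_Fin c0_ideal_def
proof (clarify)
  fix \<epsilon> :: real assume "\<epsilon> > 0"
  \<comment> \<open>Limits preserve only weak inequalities; the threshold
    \<open>\<epsilon>/2\<close> leaves room for a strict bound by \<open>\<epsilon>\<close>. Outside
    the finite set \<open>?B\<close> the large entries of a column form a set in \<open>I\<close>,
    which \<open>U\<close> avoids.\<close>
  let ?B = "{n. {m. \<epsilon>/2 \<le> \<bar>apply_bcontfun x (n, m)\<bar>} \<notin> I}"
  have "{s. \<epsilon>/2 \<le> \<bar>apply_bcontfun x s\<bar>} \<in> Fin \<times>\<^sub>F I"
    using x half_gt_zero[OF \<open>\<epsilon> > 0\<close>] unfolding c0_ideal_def by blast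
  then have "finite ?B"
    by (simp add: fubini_product_def Fin_def)
  moreover have "\<bar>apply_bcontfun (column_limits U x) n\<bar> < \<epsilon>" if "n \<notin> ?B" for n
  proof -
    have "eventually (\<lambda>m. \<bar>apply_bcontfun x (n, m)\<bar> \<le> \<epsilon>/2) U"
      using IU[of "{m. \<epsilon>/2 \<le> \<bar>apply_bcontfun x (n, m)\<bar>}"] that by (auto elim!: eventually_mono)
    then have "\<bar>apply_bcontfun (column_limits U x) n\<bar> \<le> \<epsilon>/2"
      using U by (intro tendsto_upperbound[OF tendsto_rabs[OF tendsto_column_limits[OF U]]])
        (auto simp: ultrafilter_def)
    then show ?thesis using \<open>\<epsilon> > 0\<close> by simp
  qed
  ultimately show "{n. \<epsilon> \<le> \<bar>apply_bcontfun (column_limits U x) n\<bar>} \<in> Fin"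
    unfolding Fin_def by (auto simp: not_less[symmetric] intro: finite_subset[of _ ?B])
qed

section \<open>Indicator functions and the failure of weak compactness\<close>

lemma apply_Bcontfun_indicator:
  "apply_bcontfun (Bcontfun (indicator A :: 's::discrete_topology \<Rightarrow> real)) = indicator A"
proof (rule Bcontfun_inverse, rule bcontfun_normI)
  show "norm (indicator A s :: real) \<le> 1" for s :: 's
    by (simp add: indicator_def)
qed simp

lemma norm_Bcontfun_indicator_le:
  "norm (Bcontfun (indicator A :: 's::discrete_topology \<Rightarrow> real)) \<le> 1"
  by (rule norm_bound) (simp add: apply_Bcontfun_indicator indicator_def)

lemma Bcontfun_indicator_in_c0_ideal:
  assumes "is_ideal K" "A \<in> K"
  shows "Bcontfun (indicator A) \<in> c0_ideal K"
proof -
  have "{s. \<epsilon> \<le> \<bar>indicator A s :: real\<bar>} \<subseteq> A" if "\<epsilon> > 0" for \<epsilon>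
    using that by (auto simp: indicator_def split: if_splits)
  then show ?thesis
    using assms unfolding c0_ideal_def is_ideal_def by (auto simp: apply_Bcontfun_indicator)
qed

text \<open>The set \<open>S\<close> is arbitrary so that the result applies to the weak closure of
  an image.\<close>

lemma not_compactin_weak_topology_c0:
  assumes S: "\<And>N. Bcontfun (indicator {..<N}) \<in> S"
  shows "\<not> compactin (weak_topology c0) S"
proof
  assume comp: "compactin (weak_topology c0) S"
  \<comment> \<open>Evaluation at \<open>n\<close> is a bounded functional, so \<open>V n\<close> is
    weakly open. The \<open>V n\<close> cover \<open>c0\<close> because a null sequence is
    eventually below 1.\<close>
  define V :: "nat \<Rightarrow> (nat \<Rightarrow>\<^sub>C real) set" where "V n = {y \<in> c0. apply_bcontfun y n \<in> {..<1}}" for n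
  have "openin (weak_topology c0) (V n)" for n
    unfolding weak_topology_def V_def
  proof (intro topology_generated_by_Basis CollectI exI conjI)
    show "{y \<in> c0. apply_bcontfun y n \<in> {..<1}} = {y \<in> c0. apply_bcontfun y n \<in> {..<1}}" ..
    show "bounded_linear_on c0 (\<lambda>y :: nat \<Rightarrow>\<^sub>C real. apply_bcontfun y n)"
      unfolding bounded_linear_on_def using norm_bounded[where 'b=real]
      by (auto intro!: exI[of _ 1])
  qed simp
  moreover have "S \<subseteq> \<Union>(range V)"
  proof
    fix y assume "y \<in> S"
    then have y: "y \<in> c0"
      using compactin_subset_topspace[OF comp] by (auto simp: topspace_weak_topology)
    then have "eventually (\<lambda>n. apply_bcontfun y n < 1) sequentially"
      unfolding c0_def by (auto intro: order_tendstoD)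
    then obtain n where "apply_bcontfun y n < 1"
      by (auto simp: eventually_sequentially)
    with y show "y \<in> \<Union>(range V)" by (auto simp: V_def)
  qed
  ultimately obtain \<F> where "finite \<F>" "\<F> \<subseteq> range V" "S \<subseteq> \<Union>\<F>"
    using comp unfolding compactin_def by (metis (no_types, lifting) rangeE)
  then obtain J where "finite J" and J: "S \<subseteq> \<Union>(V ` J)"
    by (metis finite_subset_image)
  \<comment> \<open>The indicator of \<open>{..<N}\<close> takes the value 1 at every index in
    \<open>J\<close>, so it escapes all chosen sets.\<close>
  then obtain N where "J \<subseteq> {..<N}"
    by (metis finite_nat_iff_bounded)
  then show False
    using J S[of N] by (auto simp: V_def apply_Bcontfun_indicator subset_eq)
qed

theorem theorem5p20:
  fixes I :: "nat set set"
  assumes "is_ideal I" and "meager_ideal I"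
  shows "\<not> grothendieck_space (c0_ideal (Fin \<times>\<^sub>F I))"
proof
  let ?X = "c0_ideal (Fin \<times>\<^sub>F I)"
  assume G: "grothendieck_space ?X"
  obtain U where U: "ultrafilter U" and IU: "\<And>A. A \<in> I \<Longrightarrow> eventually (\<lambda>m. m \<notin> A) U"
    using ultrafilter_avoiding_ideal[OF assms(1) UNIV_notin_meager_ideal[OF assms]] by blast
  let ?T = "column_limits U :: ((nat \<times> nat) \<Rightarrow>\<^sub>C real) \<Rightarrow> (nat \<Rightarrow>\<^sub>C real)"
  have into: "?T ` ?X \<subseteq> c0"
    using column_limits_c0_ideal[OF U IU] by blast
  then have comp: "compactin (weak_topology c0) (weak_topology c0 closure_of (?T ` (?X \<inter> cball 0 1)))"
    using G bounded_linear_on_column_limits[OF U]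
    unfolding grothendieck_space_def weakly_compact_operator_def by blast
  have "Bcontfun (indicator {..<N}) \<in> ?T ` (?X \<inter> cball 0 1)" for N
  proof (rule image_eqI)
    \<comment> \<open>Every column of this indicator is constant: 1 for \<open>n < N\<close>, else
      0. Columns of the rectangle from \<open>N\<close> on are empty and so belong to
      \<open>I\<close>, leaving finitely many exceptions.\<close>
    let ?x = "Bcontfun (indicator ({..<N} \<times> UNIV)) :: (nat \<times> nat) \<Rightarrow>\<^sub>C real"
    show "Bcontfun (indicator {..<N}) = ?T ?x"
      by (rule column_limits_eqI[OF U, symmetric]) (simp add: apply_Bcontfun_indicator indicator_times)
    have "{n. {m. (n, m) \<in> {..<N} \<times> (UNIV :: nat set)} \<notin> I} \<subseteq> {..<N}"
      using assms(1) by (auto simp: is_ideal_def)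
    from finite_subset[OF this] have "{..<N} \<times> UNIV \<in> Fin \<times>\<^sub>F I"
      unfolding fubini_product_def Fin_def by blast
    then show "?x \<in> ?X \<inter> cball 0 1"
      using is_ideal_fubini_product[OF is_ideal_Fin assms(1)] norm_Bcontfun_indicator_le
      by (auto intro: Bcontfun_indicator_in_c0_ideal)
  qed
  \<comment> \<open>The image lies in \<open>c0\<close>, the whole space of this topology, so it is
    contained in its closure.\<close>
  moreover have "?T ` (?X \<inter> cball 0 1) \<subseteq> weak_topology c0 closure_of (?T ` (?X \<inter> cball 0 1))"
    using into by (intro closure_of_subset) (auto simp: topspace_weak_topology)
  ultimately show False
    using not_compactin_weak_topology_c0 comp by (meson subsetD)
qed

end
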